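(* Let $\mathbf{L}$ be a set of data words, $\mathcal{I}\in\mathsf{FCons}(\mathbb{Z})$, $n\ge1$ and $k\ge0$. Then $\mathbf{L}$ is not definable in $\mathrm{TPTL}^{n,\mathcal{I}}_k$ (no formula of this set is satisfied by exactly the data words in $\mathbf{L}$) if and only if there exist $w_0\in\mathbf{L}$ and $w_1\notin\mathbf{L}$ such that Duplicator has a winning strategy in $\mathrm{TG}^{n,\mathcal{I}}_k(w_0,0,\nu^{w_0}_0,w_1,0,\nu^{w_1}_0)$, where $\nu^{w}_0$ maps every register to the first data value of $w$.
   Context: Data words: infinite sequences $w=(P_0,d_0)(P_1,d_1)\dots$, $P_i\subseteq\mathcal{P}$ ($\mathcal{P}$ finite), $d_i\in\mathbb{N}$; write $d^w_i$. Intervals have endpoints in $\mathbb{Z}\cup\{\pm\infty\}$. TPTL formulas: $\varphi::=p\mid x\in I\mid\neg\varphi\mid\varphi_1\wedge\varphi_2\mid\varphi_1\mathsf{U}\varphi_2\mid x.\varphi$; a register valuation is $\nu:X\to\mathbb{N}$; $(w,i,\nu)\models p$ iff $p\in P_i$; $(w,i,\nu)\models x\in I$ iff $d_i-\nu(x)\in I$; $(w,i,\nu)\models x.\varphi$ iff $(w,i,\nu[x\mapsto d_i])\models\varphi$; $(w,i,\nu)\models\varphi_1\mathsf{U}\varphi_2$ iff there is $j>i$ with $(w,j,\nu)\models\varphi_2$ and $(w,k,\nu)\models\varphi_1$ for all $i<k<j$. $w\models\varphi$ iff $(w,0,\nu^w_0)\models\varphi$. Until rank: $\mathrm{urk}(p)=\mathrm{urk}(x\in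 I)=0$, $\mathrm{urk}(\neg\varphi)=\mathrm{urk}(x.\varphi)=\mathrm{urk}(\varphi)$, $\mathrm{urk}(\varphi_1\wedge\varphi_2)=\max$, $\mathrm{urk}(\varphi_1\mathsf{U}\varphi_2)=\max+1$. $\mathsf{FCons}(\mathbb{Z})$: sets $S\cup\{\pm\infty\}$, $S\subseteq\mathbb{Z}$ finite. $\mathrm{TPTL}^{n,\mathcal{I}}_k$: TPTL formulas of until rank $\le k$, registers among $x_1,\dots,x_n$, all interval endpoints in constraints $x\in I$ in $\mathcal{I}$. $(i_0,\nu_0)$ and $(i_1,\nu_1)$ agree in the atomic formulas if $(w_0,i_0,\nu_0)$, $(w_1,i_1,\nu_1)$ satisfy the same $p\in\mathcal{P}$ and the same $x\in I$ with $x\in\{x_1,\dots,x_n\}$, endpoints of $I$ in $\mathcal{I}$. Game $\mathrm{TG}^{n,\mathcal{I}}_k(w_0,i_0,\nu_0,w_1,i_1,\nu_1)$: if $k=0$, Spoiler wins iff the pairs do not agree in the atomic formulas. If $k>0$: (1) if they do not agree, Spoiler wins; otherwise Spoiler chooses $Y\subseteq\{x_1,\dots,x_n\}$, sets $\nu'_l=\nu_l[x\mapsto d^{w_l}_{i_l}\text{ for }x\in Y]$ ($l=0,1$), and picks $l$ and $i'_l>i_l$ in $w_l$. (2) Duplicator picks $i'_{1-l}>i_{1-l}$; Spoiler wins unless $(i'_0,\nu'_0),(i'_1,\nu'_1)$ agree. (3) Spoiler either continues with $\mathrm{TG}^{n,\mathcal{I}}_{k-1}(w_0,i'_0,\nu'_0,w_1,i'_1,\nu'_1)$,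 or (4) picks $i''_{1-l}$ strictly between $i_{1-l}$ and $i'_{1-l}$, and Duplicator must pick $i''_l$ strictly between $i_l$ and $i'_l$ with $(i''_0,\nu'_0),(i''_1,\nu'_1)$ agreeing, else Spoiler wins; then (5) play continues with $\mathrm{TG}^{n,\mathcal{I}}_{k-1}(w_0,i''_0,\nu'_0,w_1,i''_1,\nu'_1)$. Duplicator has a winning strategy if she can avoid Spoiler winning in every round. *)

theory Defs
  imports Main "HOL-Library.Extended"
begin

type_synonym 'p data_word = "nat \<Rightarrow> 'p set \<times> nat"

abbreviation props_at :: "'p data_word \<Rightarrow> nat \<Rightarrow> 'p set" where
  "props_at w i \<equiv> fst (w i)"

abbreviation data_at :: "'p data_word \<Rightarrow> nat \<Rightarrow> nat" where
  "data_at w i \<equiv> snd (w i)"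

definition data_words :: "'p set \<Rightarrow> 'p data_word set" where
  "data_words P = {w. \<forall>i. props_at w i \<subseteq> P}"

text \<open>
  An interval is kept as a syntactic object, because its endpoints are not determined by the set
  of integers it denotes: the open interval from 1 to 3 and the closed interval from 2 to 2 are
  the same set. The four constructors are the closed, open, left-open and right-open intervals.
\<close>

datatype interval =
    Closed (lower: "int extended") (upper: "int extended")
  | Open (lower: "int extended") (upper: "int extended")
  | LOpen (lower: "int extended") (upper: "int extended")
  | ROpen (lower: "int extended") (upper: "int extended")

fun int_set :: "interval \<Rightarrow> int set" where
  "int_set (Closed a b) = {z. a \<le> Fin z \<and> Fin z \<le> b}"
| "int_set (Open a b) = {z. a < Fin z \<and> Fin z < b}"
| "int_set (LOpen a b) = {z. a < Fin z \<and> Fin z \<le> b}"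
| "int_set (ROpen a b) = {z. a \<le> Fin z \<and> Fin z < b}"

definition intervals_over :: "int extended set \<Rightarrow> interval set" where
  "intervals_over \<I> = {I. lower I \<in> \<I> \<and> upper I \<in> \<I>}"

definition FCons :: "int extended set set" where
  "FCons = {Fin ` S \<union> {-\<infinity>, \<infinity>} | S. finite S}"

text \<open>The register $x_m$ is represented by its index $m$.\<close>

type_synonym register = nat
type_synonym valuation = "register \<Rightarrow> nat"

datatype 'p tptl =
    Prop 'p
  | Constr register interval
  | Neg "'p tptl"
  | And "'p tptl" "'p tptl"
  | Until "'p tptl" "'p tptl"
  | Freeze register "'p tptl"

fun sat :: "'p data_word \<Rightarrow> nat \<Rightarrow> valuation \<Rightarrow> 'p tptl \<Rightarrow> bool" where
  "sat w i \<nu> (Prop p) \<longleftrightarrow> p \<in> props_at w i"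
| "sat w i \<nu> (Constr x I) \<longleftrightarrow> int (data_at w i) - int (\<nu> x) \<in> int_set I"
| "sat w i \<nu> (Neg \<phi>) \<longleftrightarrow> \<not> sat w i \<nu> \<phi>"
| "sat w i \<nu> (And \<phi> \<psi>) \<longleftrightarrow> sat w i \<nu> \<phi> \<and> sat w i \<nu> \<psi>"
| "sat w i \<nu> (Until \<phi> \<psi>) \<longleftrightarrow>
     (\<exists>j>i. sat w j \<nu> \<psi> \<and> (\<forall>m. i < m \<and> m < j \<longrightarrow> sat w m \<nu> \<phi>))"
| "sat w i \<nu> (Freeze x \<phi>) \<longleftrightarrow> sat w i (\<nu>(x := data_at w i)) \<phi>"

definition init_val :: "'p data_word \<Rightarrow> valuation" where
  "init_val w = (\<lambda>_. data_at w 0)"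

definition models :: "'p data_word \<Rightarrow> 'p tptl \<Rightarrow> bool" where
  "models w \<phi> \<longleftrightarrow> sat w 0 (init_val w) \<phi>"

fun urk :: "'p tptl \<Rightarrow> nat" where
  "urk (Prop p) = 0"
| "urk (Constr x I) = 0"
| "urk (Neg \<phi>) = urk \<phi>"
| "urk (And \<phi> \<psi>) = max (urk \<phi>) (urk \<psi>)"
| "urk (Until \<phi> \<psi>) = max (urk \<phi>) (urk \<psi>) + 1"
| "urk (Freeze x \<phi>) = urk \<phi>"

fun registers :: "'p tptl \<Rightarrow> register set" where
  "registers (Prop p) = {}"
| "registers (Constr x I) = {x}"
| "registers (Neg \<phi>) = registers \<phi>"
| "registers (And \<phi> \<psi>) = registers \<phi> \<union> registers \<psi>"
| "registers (Until \<phi> \<psi>) = registers \<phi> \<union> registers \<psi>"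
| "registers (Freeze x \<phi>) = insert x (registers \<phi>)"

fun constr_intervals :: "'p tptl \<Rightarrow> interval set" where
  "constr_intervals (Prop p) = {}"
| "constr_intervals (Constr x I) = {I}"
| "constr_intervals (Neg \<phi>) = constr_intervals \<phi>"
| "constr_intervals (And \<phi> \<psi>) = constr_intervals \<phi> \<union> constr_intervals \<psi>"
| "constr_intervals (Until \<phi> \<psi>) = constr_intervals \<phi> \<union> constr_intervals \<psi>"
| "constr_intervals (Freeze x \<phi>) = constr_intervals \<phi>"

definition TPTL :: "'p set \<Rightarrow> nat \<Rightarrow> int extended set \<Rightarrow> nat \<Rightarrow> 'p tptl set" where
  "TPTL P n \<I> k =
     {\<phi>. set_tptl \<phi> \<subseteq> P \<and> registers \<phi> \<subseteq> {1..n} \<and>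
         constr_intervals \<phi> \<subseteq> intervals_over \<I> \<and> urk \<phi> \<le> k}"

definition definable ::
  "'p set \<Rightarrow> nat \<Rightarrow> int extended set \<Rightarrow> nat \<Rightarrow> 'p data_word set \<Rightarrow> bool" where
  "definable P n \<I> k L \<longleftrightarrow> (\<exists>\<phi>\<in>TPTL P n \<I> k. {w \<in> data_words P. models w \<phi>} = L)"


text \<open>
  The two sides of the game are indexed by a Boolean \<open>l\<close>, with False for side 0 and True for
  side 1; the side $1 - l$ is \<open>\<not> l\<close>. Words, positions and valuations of the two sides are given
  as functions of \<open>l\<close>.
\<close>

definition two_sides :: "'a \<Rightarrow> 'a \<Rightarrow> bool \<Rightarrow> 'a" where
  "two_sides a b = (\<lambda>l. if l then b else a)"

definition agree ::
  "'p set \<Rightarrow> nat \<Rightarrow> int extended set \<Rightarrow> (bool \<Rightarrow> 'p data_word) \<Rightarrow>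
   (bool \<Rightarrow> nat) \<Rightarrow> (bool \<Rightarrow> valuation) \<Rightarrow> bool" where
  "agree P n \<I> w i \<nu> \<longleftrightarrow>
     (\<forall>p\<in>P. sat (w False) (i False) (\<nu> False) (Prop p) \<longleftrightarrow>
            sat (w True) (i True) (\<nu> True) (Prop p)) \<and>
     (\<forall>x\<in>{1..n}. \<forall>I\<in>intervals_over \<I>.
            sat (w False) (i False) (\<nu> False) (Constr x I) \<longleftrightarrow>
            sat (w True) (i True) (\<nu> True) (Constr x I))"

definition reset ::
  "(bool \<Rightarrow> 'p data_word) \<Rightarrow> register set \<Rightarrow> (bool \<Rightarrow> nat) \<Rightarrow> (bool \<Rightarrow> valuation) \<Rightarrow>
   bool \<Rightarrow> valuation" where
  "reset w Y i \<nu> = (\<lambda>l x. if x \<in> Y then data_at (w l) (i l) else \<nu> l x)"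

text \<open>
  The states of the game, where \<open>k\<close> is the number of rounds still to be played after the current
  one (in \<open>Round\<close>: the number of rounds still to be played), \<open>i\<close> the positions at the
  beginning of the round, and \<open>\<nu>\<close> the current valuations:
  \<^item> \<open>Round k i \<nu>\<close>: the start of the game with \<open>k\<close> rounds from \<open>(i, \<nu>)\<close>; Spoiler is to choose
    registers to reset, a side and a new position on that side;
  \<^item> \<open>Reply k i \<nu> l j\<close>: Spoiler has chosen position \<open>j\<close> on side \<open>l\<close>, and Duplicator is to answer
    on side \<open>\<not> l\<close>;
  \<^item> \<open>Choice k i \<nu> l i'\<close>: the new positions are \<open>i'\<close>, and Spoiler is to decide how to go on;
  \<^item> \<open>Between k i \<nu> l i' m\<close>: Spoiler has chosen \<open>m\<close> strictly between the old and the new position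
    on side \<open>\<not> l\<close>, and Duplicator is to answer on side \<open>l\<close>.
\<close>

datatype state =
    Round nat "bool \<Rightarrow> nat" "bool \<Rightarrow> valuation"
  | Reply nat "bool \<Rightarrow> nat" "bool \<Rightarrow> valuation" bool nat
  | Choice nat "bool \<Rightarrow> nat" "bool \<Rightarrow> valuation" bool "bool \<Rightarrow> nat"
  | Between nat "bool \<Rightarrow> nat" "bool \<Rightarrow> valuation" bool "bool \<Rightarrow> nat" nat

inductive move :: "nat \<Rightarrow> (bool \<Rightarrow> 'p data_word) \<Rightarrow> state \<Rightarrow> state \<Rightarrow> bool"
  for n :: nat and w :: "bool \<Rightarrow> 'p data_word" where
  "Y \<subseteq> {1..n} \<Longrightarrow> i l < j \<Longrightarrow>
     move n w (Round (Suc k) i \<nu>) (Reply k i (reset w Y i \<nu>) l j)"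
| "i (\<not> l) < j' \<Longrightarrow>
     move n w (Reply k i \<nu> l j) (Choice k i \<nu> l (\<lambda>s. if s = l then j else j'))"
| "move n w (Choice k i \<nu> l i') (Round k i' \<nu>)"
| "i (\<not> l) < m \<Longrightarrow> m < i' (\<not> l) \<Longrightarrow>
     move n w (Choice k i \<nu> l i') (Between k i \<nu> l i' m)"
| "i l < m' \<Longrightarrow> m' < i' l \<Longrightarrow>
     move n w (Between k i \<nu> l i' m) (Round k (\<lambda>s. if s = l then m' else m) \<nu>)"

fun duplicator_turn :: "state \<Rightarrow> bool" where
  "duplicator_turn (Round k i \<nu>) = False"
| "duplicator_turn (Reply k i \<nu> l j) = True"
| "duplicator_turn (Choice k i \<nu> l i') = False"
| "duplicator_turn (Between k i \<nu> l i' m) = True"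

text \<open>
  The test in \<open>Round\<close> is the one made at the start of each game, including the game with no
  rounds; after a move out of \<open>Between\<close> it is also the test of Duplicator's answer.
\<close>

fun spoiler_won ::
  "'p set \<Rightarrow> nat \<Rightarrow> int extended set \<Rightarrow> (bool \<Rightarrow> 'p data_word) \<Rightarrow> state \<Rightarrow> bool" where
  "spoiler_won P n \<I> w (Round k i \<nu>) \<longleftrightarrow> \<not> agree P n \<I> w i \<nu>"
| "spoiler_won P n \<I> w (Reply k i \<nu> l j) \<longleftrightarrow> False"
| "spoiler_won P n \<I> w (Choice k i \<nu> l i') \<longleftrightarrow> \<not> agree P n \<I> w i' \<nu>"
| "spoiler_won P n \<I> w (Between k i \<nu> l i' m) \<longleftrightarrow> False"

text \<open>
  A strategy of Duplicator maps the history of a play, that is, the nonempty list of the states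
  visited so far, to the next state. The histories below are those of the plays from \<open>s\<close> in which
  Duplicator follows \<open>\<sigma>\<close>.
\<close>

type_synonym strategy = "state list \<Rightarrow> state"

inductive history ::
  "nat \<Rightarrow> (bool \<Rightarrow> 'p data_word) \<Rightarrow> strategy \<Rightarrow> state \<Rightarrow> state list \<Rightarrow> bool"
  for n :: nat and w :: "bool \<Rightarrow> 'p data_word" and \<sigma> :: strategy and s :: state where
  "history n w \<sigma> s [s]"
| "history n w \<sigma> s h \<Longrightarrow> \<not> duplicator_turn (last h) \<Longrightarrow> move n w (last h) t \<Longrightarrow>
     history n w \<sigma> s (h @ [t])"
| "history n w \<sigma> s h \<Longrightarrow> duplicator_turn (last h) \<Longrightarrow> move n w (last h) (\<sigma> h) \<Longrightarrow>
     history n w \<sigma> s (h @ [\<sigma> h])"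

text \<open>Duplicator also loses if it is her turn and \<open>\<sigma>\<close> does not give her a legal move.\<close>

definition winning_strategy ::
  "'p set \<Rightarrow> nat \<Rightarrow> int extended set \<Rightarrow> (bool \<Rightarrow> 'p data_word) \<Rightarrow> state \<Rightarrow> strategy \<Rightarrow> bool" where
  "winning_strategy P n \<I> w s \<sigma> \<longleftrightarrow>
     (\<forall>h. history n w \<sigma> s h \<longrightarrow>
        \<not> spoiler_won P n \<I> w (last h) \<and>
        (duplicator_turn (last h) \<longrightarrow> move n w (last h) (\<sigma> h)))"

definition duplicator_wins_TG ::
  "'p set \<Rightarrow> nat \<Rightarrow> int extended set \<Rightarrow> nat \<Rightarrow> 'p data_word \<Rightarrow> nat \<Rightarrow> valuation \<Rightarrow>
   'p data_word \<Rightarrow> nat \<Rightarrow> valuation \<Rightarrow> bool" where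
  "duplicator_wins_TG P n \<I> k w0 i0 \<nu>0 w1 i1 \<nu>1 \<longleftrightarrow>
     (\<exists>\<sigma>. winning_strategy P n \<I> (two_sides w0 w1)
            (Round k (two_sides i0 i1) (two_sides \<nu>0 \<nu>1)) \<sigma>)"

end

theory Submission
  imports Defs
begin

text \<open>
  Up to logical equivalence there are only finitely many formulas of until rank at most \<open>k\<close>:
  freeze quantifiers commute with the Boolean connectives and trivialise constraints on the frozen
  register, so the truth of such a formula depends only on the atoms and on the until formulas of
  smaller rank evaluated after resetting some set of registers. Hence every set of configurations
  that is closed under rank-\<open>k\<close> equivalence is definable. The same normal form shows that a
  winning strategy for Duplicator preserves all formulas of rank \<open>k\<close>. Conversely, when Spoiler
  moves to \<open>j\<close>, Duplicator's answer is a witness for the until formula whose right argument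
  describes the rank-\<open>(k - 1)\<close> class of \<open>j\<close> and whose left argument describes the classes of the
  positions skipped.
\<close>

section \<open>Winning strategies\<close>

text \<open>Allows a strategy from \<open>s\<close> to be restarted at a successor \<open>t\<close>:
  prefixing \<open>s\<close> restores the history that \<open>\<sigma>\<close> expects. If
  Duplicator is to move at \<open>s\<close>, then \<open>t\<close> has to be her own answer.\<close>

lemma history_Cons:
  assumes h: "history n w (\<lambda>h. \<sigma> (s # h)) t h"
    and t: "move n w s t" "duplicator_turn s \<Longrightarrow> t = \<sigma> [s]"
  shows "history n w \<sigma> s (s # h)"
  using h
proof induction
  case 1
  have s: "history n w \<sigma> s [s]" by (rule history.intros)
  show ?case
  proof (cases "duplicator_turn s")
    case True
    then show ?thesis using history.intros(3)[OF s] t by simp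
  next
    case False
    then show ?thesis using history.intros(2)[OF s] t by simp
  qed
next
  case (2 h t')
  \<comment> \<open>Nonemptiness gives \<open>last (s # h) = last h\<close>.\<close>
  then have "h \<noteq> []" by (auto elim: history.cases)
  then show ?case using history.intros(2)[OF 2(4), of t'] 2 by simp
next
  case (3 h)
  then have "h \<noteq> []" by (auto elim: history.cases)
  then show ?case using history.intros(3)[OF 3(4)] 3 by simp
qed

lemma winning_strategy_not_spoiler_won:
  "winning_strategy P n \<I> w s \<sigma> \<Longrightarrow> \<not> spoiler_won P n \<I> w s"
  unfolding winning_strategy_def using history.intros(1) by fastforce

lemma winning_strategy_tail:
  assumes win: "winning_strategy P n \<I> w s \<sigma>"
    and t: "move n w s t" "duplicator_turn s \<Longrightarrow> t = \<sigma> [s]"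
  shows "winning_strategy P n \<I> w t (\<lambda>h. \<sigma> (s # h))"
  unfolding winning_strategy_def
proof (intro allI impI)
  fix h assume h: "history n w (\<lambda>h. \<sigma> (s # h)) t h"
  then have "h \<noteq> []" by (auto elim: history.cases)
  then show "\<not> spoiler_won P n \<I> w (last h) \<and>
      (duplicator_turn (last h) \<longrightarrow> move n w (last h) (\<sigma> (s # h)))"
    using win history_Cons[OF h t] unfolding winning_strategy_def by fastforce
qed

lemma winning_strategy_spoiler_move:
  assumes "winning_strategy P n \<I> w s \<sigma>" "\<not> duplicator_turn s" "move n w s t"
  shows "\<exists>\<sigma>'. winning_strategy P n \<I> w t \<sigma>'"
  using winning_strategy_tail[OF assms(1,3)] assms(2) by blast

lemma winning_strategy_duplicator_move:
  assumes "winning_strategy P n \<I> w s \<sigma>" "duplicator_turn s"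
  shows "\<exists>t \<sigma>'. move n w s t \<and> winning_strategy P n \<I> w t \<sigma>'"
proof -
  have "move n w s (\<sigma> [s])"
    using assms history.intros(1) unfolding winning_strategy_def by fastforce
  then show ?thesis using winning_strategy_tail[OF assms(1)] by blast
qed

text \<open>A strategy looking only at the last state suffices: it chooses any move that stays
  inside \<open>W\<close>, and induction on histories shows that no play leaves
  \<open>W\<close>.\<close>

lemma winning_strategy_if_invariant:
  assumes "W s"
    and safe: "\<And>s. W s \<Longrightarrow> \<not> spoiler_won P n \<I> w s"
    and spoiler: "\<And>s t. W s \<Longrightarrow> \<not> duplicator_turn s \<Longrightarrow> move n w s t \<Longrightarrow> W t"
    and duplicator: "\<And>s. W s \<Longrightarrow> duplicator_turn s \<Longrightarrow> \<exists>t. move n w s t \<and> W t"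
  shows "\<exists>\<sigma>. winning_strategy P n \<I> w s \<sigma>"
proof
  let ?\<sigma> = "\<lambda>h. SOME t. move n w (last h) t \<and> W t"
  have \<sigma>: "move n w (last h) (?\<sigma> h) \<and> W (?\<sigma> h)" if "W (last h)" "duplicator_turn (last h)" for h
    using someI_ex[OF duplicator[OF that]] .
  have "W (last h)" if "history n w ?\<sigma> s h" for h
    using that by induction (use \<open>W s\<close> spoiler \<sigma> in auto)
  then show "winning_strategy P n \<I> w s ?\<sigma>"
    unfolding winning_strategy_def using safe \<sigma> by blast
qed

section \<open>Equivalence up to a given until rank\<close>

lemma two_sides_simps [simp]: "two_sides a b False = a" "two_sides a b True = b"
  by (simp_all add: two_sides_def)

lemma reset_empty [simp]: "reset w {} i \<nu> = \<nu>"
  by (simp add: reset_def)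

lemma reset_insert:
  "(reset w Y i \<nu> l)(x := data_at (w l) (i l)) = reset w (insert x Y) i \<nu> l"
  by (auto simp: reset_def)

lemma finite_intervals_over:
  assumes "\<I> \<in> FCons"
  shows "finite (intervals_over \<I>)"
proof -
  have "intervals_over \<I> \<subseteq> (\<Union>f\<in>{Closed, Open, LOpen, ROpen}. case_prod f ` (\<I> \<times> \<I>))"
    (is "_ \<subseteq> ?S")
  proof
    fix I assume "I \<in> intervals_over \<I>"
    then show "I \<in> ?S" by (cases I) (force simp: intervals_over_def)+
  qed
  moreover have "finite ?S"
    using assms by (auto simp: FCons_def)
  ultimately show ?thesis by (rule finite_subset)
qed

lemma TPTL_simps [simp]:
  "Prop p \<in> TPTL P n \<I> k \<longleftrightarrow> p \<in> P"
  "Constr x I \<in> TPTL P n \<I> k \<longleftrightarrow> x \<in> {1..n} \<and> I \<in> intervals_over \<I>"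
  "Neg \<phi> \<in> TPTL P n \<I> k \<longleftrightarrow> \<phi> \<in> TPTL P n \<I> k"
  "And \<phi> \<psi> \<in> TPTL P n \<I> k \<longleftrightarrow> \<phi> \<in> TPTL P n \<I> k \<and> \<psi> \<in> TPTL P n \<I> k"
  "Until \<phi> \<psi> \<in> TPTL P n \<I> (Suc k) \<longleftrightarrow> \<phi> \<in> TPTL P n \<I> k \<and> \<psi> \<in> TPTL P n \<I> k"
  "Until \<phi> \<psi> \<notin> TPTL P n \<I> 0"
  "Freeze x \<phi> \<in> TPTL P n \<I> k \<longleftrightarrow> x \<in> {1..n} \<and> \<phi> \<in> TPTL P n \<I> k"
  unfolding TPTL_def by auto

text \<open>The normal form in usable shape: \<open>Freeze x\<close> merely enlarges
  \<open>Y\<close>, which is why \<open>Y\<close> varies in the induction, and until subformulas are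
  not unfolded but left to the hypothesis \<open>until\<close>.\<close>

lemma sat_reset_cong:
  assumes "\<phi> \<in> TPTL P n \<I> k" "Y \<subseteq> {1..n}"
    and agree: "agree P n \<I> w i \<nu>"
    and until: "\<And>Y \<phi> \<psi>. Y \<subseteq> {1..n} \<Longrightarrow> Until \<phi> \<psi> \<in> TPTL P n \<I> k \<Longrightarrow>
      sat (w False) (i False) (reset w Y i \<nu> False) (Until \<phi> \<psi>) \<longleftrightarrow>
      sat (w True) (i True) (reset w Y i \<nu> True) (Until \<phi> \<psi>)"
  shows "sat (w False) (i False) (reset w Y i \<nu> False) \<phi> \<longleftrightarrow>
    sat (w True) (i True) (reset w Y i \<nu> True) \<phi>"
  using assms(1,2)
proof (induction \<phi> arbitrary: Y)
  case (Prop p)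
  then show ?case using agree by (simp add: agree_def)
next
  case (Constr x I)
  \<comment> \<open>For a register in \<open>Y\<close> the tested difference is 0 on both
    sides.\<close>
  then show ?case using agree by (auto simp: agree_def reset_def)
next
  case (Until \<phi> \<psi>)
  then show ?case using until by blast
next
  case (Freeze x \<phi>)
  then show ?case by (simp add: reset_insert)
qed simp_all

definition tptl_equiv ::
  "'p set \<Rightarrow> nat \<Rightarrow> int extended set \<Rightarrow> nat \<Rightarrow> (bool \<Rightarrow> 'p data_word) \<Rightarrow>
   (bool \<Rightarrow> nat) \<Rightarrow> (bool \<Rightarrow> valuation) \<Rightarrow> bool" where
  "tptl_equiv P n \<I> k w i \<nu> \<longleftrightarrow>
     (\<forall>\<phi>\<in>TPTL P n \<I> k. sat (w False) (i False) (\<nu> False) \<phi> \<longleftrightarrow> sat (w True) (i True) (\<nu> True) \<phi>)"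

lemma tptl_equiv_imp_agree: "tptl_equiv P n \<I> k w i \<nu> \<Longrightarrow> agree P n \<I> w i \<nu>"
  unfolding agree_def tptl_equiv_def by (metis TPTL_simps(1,2))

lemma tptl_equivD:
  assumes "tptl_equiv P n \<I> k w i \<nu>" "\<phi> \<in> TPTL P n \<I> k"
  shows "sat (w l) (i l) (\<nu> l) \<phi> \<longleftrightarrow> sat (w l') (i l') (\<nu> l') \<phi>"
  using assms unfolding tptl_equiv_def by (cases l; cases l') auto

text \<open>Induction on \<open>k\<close>. Spoiler can test any until formula: he resets
  \<open>Y\<close>, moves to a witness on the side where the formula holds, and may then challenge a
  position that Duplicator skipped.\<close>

lemma tptl_equiv_if_winning_strategy:
  assumes "winning_strategy P n \<I> w (Round k i \<nu>) \<sigma>"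
  shows "tptl_equiv P n \<I> k w i \<nu>"
  using assms
proof (induction k arbitrary: i \<nu> \<sigma>)
  case 0
  then have "agree P n \<I> w i \<nu>" using winning_strategy_not_spoiler_won by fastforce
  \<comment> \<open>At rank 0 there are no until formulas, and resetting \<open>{}\<close> changes
    nothing.\<close>
  then show ?case
    using sat_reset_cong[of _ P n \<I> 0 "{}" w i \<nu>] by (simp add: tptl_equiv_def)
next
  case (Suc k)
  have agree: "agree P n \<I> w i \<nu>"
    using winning_strategy_not_spoiler_won[OF Suc.prems] by simp
  \<comment> \<open>One implication for arbitrary \<open>l\<close> suffices; the converse is the
    instance with the other side.\<close>
  have until: "sat (w (\<not> l)) (i (\<not> l)) (reset w Y i \<nu> (\<not> l)) (Until \<phi> \<psi>)"
    if Y: "Y \<subseteq> {1..n}" and U: "Until \<phi> \<psi> \<in> TPTL P n \<I> (Suc k)"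
      and l: "sat (w l) (i l) (reset w Y i \<nu> l) (Until \<phi> \<psi>)" for Y \<phi> \<psi> l
  proof -
    let ?\<nu> = "reset w Y i \<nu>"
    obtain j where j: "i l < j" "sat (w l) j (?\<nu> l) \<psi>"
      "\<And>m. i l < m \<Longrightarrow> m < j \<Longrightarrow> sat (w l) m (?\<nu> l) \<phi>"
      using l by auto
    obtain \<sigma>1 where "winning_strategy P n \<I> w (Reply k i ?\<nu> l j) \<sigma>1"
      using winning_strategy_spoiler_move[OF Suc.prems] move.intros(1)[of Y n i l j w k \<nu>] Y j(1)
      by auto
    then obtain t \<sigma>2 where "move n w (Reply k i ?\<nu> l j) t" "winning_strategy P n \<I> w t \<sigma>2"
      using winning_strategy_duplicator_move by fastforce
    then obtain j' where j': "i (\<not> l) < j'"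
      and win: "winning_strategy P n \<I> w (Choice k i ?\<nu> l (\<lambda>s. if s = l then j else j')) \<sigma>2"
      by (auto elim: move.cases)
    let ?i = "\<lambda>s. if s = l then j else j'"
    \<comment> \<open>Spoiler may continue from \<open>j\<close> and \<open>j'\<close>, so these are
      equivalent at rank \<open>k\<close> and \<open>\<psi>\<close> carries over.\<close>
    have "tptl_equiv P n \<I> k w ?i ?\<nu>"
      using winning_strategy_spoiler_move[OF win _ move.intros(3)] Suc.IH by auto
    then have "sat (w (\<not> l)) j' (?\<nu> (\<not> l)) \<psi>"
      using tptl_equivD[of P n \<I> k w ?i ?\<nu> \<psi> "\<not> l" l] U j(2) by simp
    \<comment> \<open>Spoiler may instead challenge \<open>m\<close>. The answer \<open>m'\<close>
      lies before \<open>j\<close>, where \<open>\<phi>\<close> holds, and is equivalent to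
      \<open>m\<close> at rank \<open>k\<close>.\<close>
    moreover have "sat (w (\<not> l)) m (?\<nu> (\<not> l)) \<phi>" if m: "i (\<not> l) < m" "m < j'" for m
    proof -
      obtain \<sigma>3 where "winning_strategy P n \<I> w (Between k i ?\<nu> l ?i m) \<sigma>3"
        using winning_strategy_spoiler_move[OF win] move.intros(4)[of i l m ?i n w k ?\<nu>] m by auto
      then obtain t \<sigma>4 where "move n w (Between k i ?\<nu> l ?i m) t" "winning_strategy P n \<I> w t \<sigma>4"
        using winning_strategy_duplicator_move by fastforce
      then obtain m' where m': "i l < m'" "m' < j"
        and "winning_strategy P n \<I> w (Round k (\<lambda>s. if s = l then m' else m) ?\<nu>) \<sigma>4"
        by (auto elim: move.cases)
      then have "tptl_equiv P n \<I> k w (\<lambda>s. if s = l then m' else m) ?\<nu>"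
        using Suc.IH by blast
      then show ?thesis
        using tptl_equivD[of P n \<I> k w "\<lambda>s. if s = l then m' else m" ?\<nu> \<phi> "\<not> l" l] U j(3)[OF m']
        by simp
    qed
    ultimately show ?thesis using j' by auto
  qed
  have "sat (w False) (i False) (reset w Y i \<nu> False) (Until \<phi> \<psi>) \<longleftrightarrow>
      sat (w True) (i True) (reset w Y i \<nu> True) (Until \<phi> \<psi>)"
    if "Y \<subseteq> {1..n}" "Until \<phi> \<psi> \<in> TPTL P n \<I> (Suc k)" for Y \<phi> \<psi>
    using until[OF that, of False] until[OF that, of True] by (simp del: sat.simps) blast
  then show ?case
    using sat_reset_cong[of _ P n \<I> "Suc k" "{}" w i \<nu>, OF _ _ agree]
    unfolding tptl_equiv_def by simp
qed

section \<open>Finiteness of the rank equivalence and definability of its classes\<close>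

type_synonym 'p config = "'p data_word \<times> nat \<times> valuation"

text \<open>Equal extensions mean logical equivalence, so a finite set of extensions expresses
  finiteness up to equivalence. The words range over the whole type, not just
  \<open>data_words P\<close>.\<close>

definition extension :: "'p tptl \<Rightarrow> 'p config set" where
  "extension \<phi> = {(w, i, \<nu>). sat w i \<nu> \<phi>}"

lemma mem_extension [simp]: "(w, i, \<nu>) \<in> extension \<phi> \<longleftrightarrow> sat w i \<nu> \<phi>"
  by (simp add: extension_def)

text \<open>Each configuration gets one of finitely many patterns that decides all formulas of rank
  \<open>k\<close>, so every extension is a union of pattern classes. The set \<open>E\<close>
  collects the extensions of the arguments of until formulas.\<close>

lemma finite_extensions_step:
  assumes P: "finite P" and \<I>: "\<I> \<in> FCons" and E: "finite E"
    and until: "\<And>\<phi> \<psi>. Until \<phi> \<psi> \<in> TPTL P n \<I> k \<Longrightarrow> extension \<phi> \<in> E \<and> extension \<psi> \<in> E"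
  shows "finite (extension ` TPTL P n \<I> k)"
proof -
  define atoms :: "'a config \<Rightarrow> _" where "atoms = (\<lambda>(w, i, \<nu>).
    (P \<inter> props_at w i, {(x, I) \<in> {1..n} \<times> intervals_over \<I>. sat w i \<nu> (Constr x I)}))"
  \<comment> \<open>An until formula depends on its arguments only through their extensions, so the
    finitely many triples \<open>(Y, A, B)\<close> cover all until formulas after all
    resets.\<close>
  define untils :: "'a config \<Rightarrow> _" where "untils = (\<lambda>(w, i, \<nu>). {(Y, A, B) \<in> Pow {1..n} \<times> E \<times> E.
    \<exists>j>i. (w, j, \<lambda>x. if x \<in> Y then data_at w i else \<nu> x) \<in> B \<and>
      (\<forall>m. i < m \<and> m < j \<longrightarrow> (w, m, \<lambda>x. if x \<in> Y then data_at w i else \<nu> x) \<in> A)})"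
  define pat where "pat c = (atoms c, untils c)" for c
  have "range pat \<subseteq> (Pow P \<times> Pow ({1..n} \<times> intervals_over \<I>)) \<times> Pow (Pow {1..n} \<times> E \<times> E)"
    by (auto simp: pat_def atoms_def untils_def)
  then have fin: "finite (range pat)"
    by (rule finite_subset) (simp add: P E finite_intervals_over[OF \<I>])
  have pat_cong: "sat w0 i0 \<nu>0 \<phi> \<longleftrightarrow> sat w1 i1 \<nu>1 \<phi>"
    if pat: "pat (w0, i0, \<nu>0) = pat (w1, i1, \<nu>1)" and \<phi>: "\<phi> \<in> TPTL P n \<I> k"
    for w0 i0 \<nu>0 w1 i1 \<nu>1 \<phi>
  proof -
    let ?w = "two_sides w0 w1" and ?i = "two_sides i0 i1" and ?\<nu> = "two_sides \<nu>0 \<nu>1"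
    have "p \<in> props_at w0 i0 \<longleftrightarrow> p \<in> props_at w1 i1" if "p \<in> P" for p
    proof -
      have "p \<in> fst (atoms (w0, i0, \<nu>0)) \<longleftrightarrow> p \<in> fst (atoms (w1, i1, \<nu>1))"
        using pat by (simp add: pat_def)
      then show ?thesis using that by (simp add: atoms_def)
    qed
    moreover have "sat w0 i0 \<nu>0 (Constr x I) \<longleftrightarrow> sat w1 i1 \<nu>1 (Constr x I)"
      if "x \<in> {1..n}" "I \<in> intervals_over \<I>" for x I
    proof -
      have "(x, I) \<in> snd (atoms (w0, i0, \<nu>0)) \<longleftrightarrow> (x, I) \<in> snd (atoms (w1, i1, \<nu>1))"
        using pat by (simp add: pat_def)
      then show ?thesis using that by (simp add: atoms_def)
    qed
    ultimately have "agree P n \<I> ?w ?i ?\<nu>"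
      by (simp add: agree_def)
    moreover have "sat w0 i0 (reset ?w Y ?i ?\<nu> False) (Until \<chi> \<psi>) \<longleftrightarrow>
        sat w1 i1 (reset ?w Y ?i ?\<nu> True) (Until \<chi> \<psi>)"
      if Y: "Y \<subseteq> {1..n}" and U: "Until \<chi> \<psi> \<in> TPTL P n \<I> k" for Y \<chi> \<psi>
    proof -
      have "(Y, extension \<chi>, extension \<psi>) \<in> untils (w0, i0, \<nu>0) \<longleftrightarrow>
          (Y, extension \<chi>, extension \<psi>) \<in> untils (w1, i1, \<nu>1)"
        using pat by (simp add: pat_def)
      then show ?thesis using Y until[OF U] by (simp add: untils_def reset_def cong: if_cong)
    qed
    ultimately show ?thesis
      using sat_reset_cong[OF \<phi>, of "{}" ?w ?i ?\<nu>] by simp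
  qed
  have "extension ` TPTL P n \<I> k \<subseteq> vimage pat ` Pow (range pat)"
  proof
    fix A assume "A \<in> extension ` TPTL P n \<I> k"
    then obtain \<phi> where \<phi>: "\<phi> \<in> TPTL P n \<I> k" "A = extension \<phi>" by blast
    \<comment> \<open>By \<open>pat_cong\<close>, \<open>A\<close> is determined by the set of its
      patterns.\<close>
    have "A = pat -` (pat ` A)"
    proof (intro equalityI subsetI)
      fix c assume "c \<in> pat -` (pat ` A)"
      then obtain d where d: "d \<in> A" "pat d = pat c" by auto
      obtain w i \<nu> w' i' \<nu>' where "c = (w, i, \<nu>)" "d = (w', i', \<nu>')" by (cases c; cases d)
      then show "c \<in> A" using d pat_cong[of w' i' \<nu>' w i \<nu> \<phi>] \<phi> by simp
    qed blast
    then show "A \<in> vimage pat ` Pow (range pat)" by blast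
  qed
  then show ?thesis using fin by (meson finite_surj finite_Pow_iff)
qed

lemma finite_extensions:
  assumes "finite P" "\<I> \<in> FCons"
  shows "finite (extension ` TPTL P n \<I> k)"
proof (induction k)
  case 0
  \<comment> \<open>Without until formulas at rank 0, the empty \<open>E\<close> satisfies the
    hypothesis vacuously; in the successor case \<open>E\<close> consists of the extensions of rank
    \<open>k\<close>.\<close>
  show ?case by (rule finite_extensions_step[OF assms, of "{}"]) simp_all
next
  case (Suc k)
  show ?case by (rule finite_extensions_step[OF assms Suc]) simp
qed

text \<open>In a finite Boolean algebra of sets, the members containing \<open>a\<close> intersect
  in an atom, and a saturated set is the union of the atoms of its elements.\<close>

lemma saturated_mem_finite_algebra:
  assumes D: "finite D" "UNIV \<in> D"
    and compl: "\<And>X. X \<in> D \<Longrightarrow> - X \<in> D"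
    and int: "\<And>X Y. X \<in> D \<Longrightarrow> Y \<in> D \<Longrightarrow> X \<inter> Y \<in> D"
    and A: "\<And>a b. a \<in> A \<Longrightarrow> \<forall>X\<in>D. a \<in> X \<longrightarrow> b \<in> X \<Longrightarrow> b \<in> A"
  shows "A \<in> D"
proof -
  \<comment> \<open>The empty intersection is \<open>UNIV\<close>, whence the assumption on
    \<open>UNIV\<close>.\<close>
  have Inter: "\<Inter>F \<in> D" if "F \<subseteq> D" for F
    using finite_subset[OF that D(1)] that by (induction F rule: finite_induct) (use D int in auto)
  have Union: "\<Union>F \<in> D" if "F \<subseteq> D" for F
  proof -
    have "\<Union>F = - \<Inter>(uminus ` F)" by auto
    moreover have "uminus ` F \<subseteq> D" using compl that by auto
    ultimately show ?thesis using compl Inter by metis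
  qed
  have "A = \<Union>((\<lambda>a. \<Inter>{X \<in> D. a \<in> X}) ` A)" using A by auto
  also have "\<dots> \<in> D" by (rule Union) (auto intro: Inter)
  finally show ?thesis .
qed

text \<open>Extensions form a finite Boolean algebra, and closure under equivalence is saturation
  with respect to it.\<close>

lemma tptl_equiv_closed_definable:
  assumes "finite P" and \<I>: "\<I> \<in> FCons" and "n \<ge> 1"
    and A: "\<And>w i \<nu> w' i' \<nu>'. (w, i, \<nu>) \<in> A \<Longrightarrow>
      tptl_equiv P n \<I> k (two_sides w w') (two_sides i i') (two_sides \<nu> \<nu>') \<Longrightarrow> (w', i', \<nu>') \<in> A"
  obtains \<phi> where "\<phi> \<in> TPTL P n \<I> k" "\<And>w i \<nu>. sat w i \<nu> \<phi> \<longleftrightarrow> (w, i, \<nu>) \<in> A"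
proof -
  let ?D = "extension ` TPTL P n \<I> k"
  have compl: "- X \<in> ?D" if X: "X \<in> ?D" for X
  proof -
    obtain \<phi> where "\<phi> \<in> TPTL P n \<I> k" "X = extension \<phi>" using X by blast
    then show ?thesis by (intro image_eqI[of _ _ "Neg \<phi>"]) (auto simp: extension_def)
  qed
  have "A \<in> ?D"
  proof (rule saturated_mem_finite_algebra)
    show "finite ?D" using assms by (intro finite_extensions)
    \<comment> \<open>A tautology: \<open>n \<ge> 1\<close> provides register 1, and every set in
      \<open>FCons\<close> contains both infinities.\<close>
    let ?T = "Constr 1 (Closed (-\<infinity>) \<infinity>)"
    have "?T \<in> TPTL P n \<I> k" using \<I> \<open>n \<ge> 1\<close> by (auto simp: FCons_def intervals_over_def)
    moreover have "extension ?T = UNIV" by (auto simp: extension_def)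
    ultimately show "UNIV \<in> ?D" by (metis imageI)
  next
    fix X Y assume "X \<in> ?D" "Y \<in> ?D"
    then obtain \<phi> \<psi> where "\<phi> \<in> TPTL P n \<I> k" "X = extension \<phi>"
      "\<psi> \<in> TPTL P n \<I> k" "Y = extension \<psi>" by blast
    then show "X \<inter> Y \<in> ?D"
      by (intro image_eqI[of _ _ "And \<phi> \<psi>"]) (auto simp: extension_def)
  next
    fix a b assume a: "a \<in> A" and sub: "\<forall>X\<in>?D. a \<in> X \<longrightarrow> b \<in> X"
    obtain w i \<nu> w' i' \<nu>' where ab: "a = (w, i, \<nu>)" "b = (w', i', \<nu>')" by (cases a; cases b)
    \<comment> \<open>The converse implication comes from applying \<open>sub\<close> to the
      negation.\<close>
    have "sat w i \<nu> \<phi> \<longleftrightarrow> sat w' i' \<nu>' \<phi>" if \<phi>: "\<phi> \<in> TPTL P n \<I> k" for \<phi>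
      using sub[rule_format, of "extension \<phi>"] sub[rule_format, of "extension (Neg \<phi>)"] \<phi> ab
      by auto
    then show "b \<in> A" using A[of w i \<nu> w' i' \<nu>'] a ab by (simp add: tptl_equiv_def)
  qed (rule compl)
  then obtain \<phi> where \<phi>: "\<phi> \<in> TPTL P n \<I> k" "A = extension \<phi>" by blast
  show ?thesis by (rule that[OF \<phi>(1)]) (simp add: \<phi>(2))
qed

lemma tptl_equiv_trans:
  assumes "tptl_equiv P n \<I> k (two_sides w w') (two_sides i i') (two_sides \<nu> \<nu>')"
    and "tptl_equiv P n \<I> k (two_sides w' w'') (two_sides i' i'') (two_sides \<nu>' \<nu>'')"
  shows "tptl_equiv P n \<I> k (two_sides w w'') (two_sides i i'') (two_sides \<nu> \<nu>'')"
  using assms by (simp add: tptl_equiv_def)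

text \<open>Replaces a possibly infinite disjunction of class descriptions by a single formula: by
  transitivity, the union of the classes met by \<open>S\<close> is closed under
  equivalence.\<close>

lemma tptl_equiv_class_formula:
  assumes "finite P" "\<I> \<in> FCons" "n \<ge> 1"
  obtains \<phi> where "\<phi> \<in> TPTL P n \<I> k"
    "\<And>w i \<nu>. sat w i \<nu> \<phi> \<longleftrightarrow> (\<exists>(w', i', \<nu>') \<in> S.
       tptl_equiv P n \<I> k (two_sides w' w) (two_sides i' i) (two_sides \<nu>' \<nu>))"
proof -
  let ?A = "{(w, i, \<nu>). \<exists>(w', i', \<nu>') \<in> S.
       tptl_equiv P n \<I> k (two_sides w' w) (two_sides i' i) (two_sides \<nu>' \<nu>)}"
  show ?thesis
  proof (rule tptl_equiv_closed_definable[OF assms, of ?A k])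
    show "(w', i', \<nu>') \<in> ?A" if "(w, i, \<nu>) \<in> ?A"
      "tptl_equiv P n \<I> k (two_sides w w') (two_sides i i') (two_sides \<nu> \<nu>')" for w i \<nu> w' i' \<nu>'
      using that tptl_equiv_trans by fast
  qed (rule that, simp_all)
qed

section \<open>Duplicator wins from equivalent configurations\<close>

text \<open>A reset of finitely many registers is a sequence of freeze quantifiers, which leave the
  until rank unchanged.\<close>

lemma tptl_equiv_reset:
  assumes "tptl_equiv P n \<I> k w i \<nu>" "Y \<subseteq> {1..n}"
  shows "tptl_equiv P n \<I> k w i (reset w Y i \<nu>)"
proof -
  have "finite Y" using assms(2) finite_subset by blast
  then show ?thesis using assms(2)
  proof (induction Y rule: finite_induct)
    case empty
    then show ?case using assms(1) by simp
  next
    case (insert x Y)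
    then have "tptl_equiv P n \<I> k w i (reset w Y i \<nu>)" by simp
    then have "sat (w False) (i False) (reset w Y i \<nu> False) (Freeze x \<phi>) \<longleftrightarrow>
      sat (w True) (i True) (reset w Y i \<nu> True) (Freeze x \<phi>)" if "\<phi> \<in> TPTL P n \<I> k" for \<phi>
      unfolding tptl_equiv_def using that insert.prems by (meson TPTL_simps(7) insert_subset)
    then show ?case by (simp add: tptl_equiv_def reset_insert)
  qed
qed

text \<open>Class formulas list Spoiler's side first; since equivalence is symmetric, this order is
  harmless for either value of \<open>l\<close>.\<close>

lemma tptl_equiv_two_sides:
  "tptl_equiv P n \<I> k (two_sides (w l) (w (\<not> l))) (two_sides a b) (two_sides (\<nu> l) (\<nu> (\<not> l))) \<longleftrightarrow>
    tptl_equiv P n \<I> k w (\<lambda>s. if s = l then a else b) \<nu>"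
  unfolding tptl_equiv_def by (cases l) auto

text \<open>A single until formula secures both the answer \<open>j'\<close> and, in advance, a
  response \<open>m'\<close> to every later challenge \<open>m\<close>.\<close>

lemma tptl_equiv_reply:
  assumes "finite P" "\<I> \<in> FCons" "n \<ge> 1"
    and eq: "tptl_equiv P n \<I> (Suc k) w i \<nu>" and j: "i l < j"
  obtains j' where "i (\<not> l) < j'" "tptl_equiv P n \<I> k w (\<lambda>s. if s = l then j else j') \<nu>"
    "\<And>m. i (\<not> l) < m \<Longrightarrow> m < j' \<Longrightarrow>
      \<exists>m'. i l < m' \<and> m' < j \<and> tptl_equiv P n \<I> k w (\<lambda>s. if s = l then m' else m) \<nu>"
proof -
  \<comment> \<open>\<open>\<psi>\<close> describes the class of \<open>j\<close>;
    \<open>\<phi>\<close> below describes the classes of all positions strictly between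
    \<open>i l\<close> and \<open>j\<close>.\<close>
  obtain \<psi> where \<psi>: "\<psi> \<in> TPTL P n \<I> k" "\<And>v a \<mu>. sat v a \<mu> \<psi> \<longleftrightarrow>
      tptl_equiv P n \<I> k (two_sides (w l) v) (two_sides j a) (two_sides (\<nu> l) \<mu>)"
    by (rule tptl_equiv_class_formula[OF assms(1-3), of k "{(w l, j, \<nu> l)}"]) auto
  obtain \<phi> where \<phi>: "\<phi> \<in> TPTL P n \<I> k" "\<And>v a \<mu>. sat v a \<mu> \<phi> \<longleftrightarrow>
      (\<exists>m'. i l < m' \<and> m' < j \<and>
        tptl_equiv P n \<I> k (two_sides (w l) v) (two_sides m' a) (two_sides (\<nu> l) \<mu>))"
    by (rule tptl_equiv_class_formula[OF assms(1-3), of k "(\<lambda>m. (w l, m, \<nu> l)) ` {i l<..<j}"])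
      (auto simp: Bex_def)
  have refl: "tptl_equiv P n \<I> k (two_sides v v) (two_sides a a) (two_sides \<mu> \<mu>)" for v a \<mu>
    by (simp add: tptl_equiv_def)
  have "sat (w l) (i l) (\<nu> l) (Until \<phi> \<psi>)"
    unfolding sat.simps \<phi>(2) \<psi>(2) using j refl by (intro exI[of _ j]) blast
  then have "sat (w (\<not> l)) (i (\<not> l)) (\<nu> (\<not> l)) (Until \<phi> \<psi>)"
    using tptl_equivD[OF eq, of "Until \<phi> \<psi>" l "\<not> l"] \<phi>(1) \<psi>(1) by (simp del: sat.simps)
  then show ?thesis
    using that by (auto simp: \<phi>(2) \<psi>(2) tptl_equiv_two_sides)
qed

lemma winning_strategy_if_tptl_equiv:
  assumes fin: "finite P" "\<I> \<in> FCons" "n \<ge> 1"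
    and eq: "tptl_equiv P n \<I> k w i \<nu>"
  shows "\<exists>\<sigma>. winning_strategy P n \<I> w (Round k i \<nu>) \<sigma>"
proof -
  \<comment> \<open>The invariant \<open>W\<close> must remember promises: \<open>btw\<close> says
    that a challenge \<open>m\<close> has an answer, and \<open>ch\<close> adds to the equivalence
    of the new positions that all admissible challenges do.\<close>
  define btw where "btw k i \<nu> l i' m \<longleftrightarrow>
    (\<exists>m'. i l < m' \<and> m' < i' l \<and> tptl_equiv P n \<I> k w (\<lambda>s. if s = l then m' else m) \<nu>)"
    for k i \<nu> l i' m
  define ch where "ch k i \<nu> l i' \<longleftrightarrow> tptl_equiv P n \<I> k w i' \<nu> \<and>
    (\<forall>m. i (\<not> l) < m \<and> m < i' (\<not> l) \<longrightarrow> btw k i \<nu> l i' m)" for k i \<nu> l i'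
  define W where "W s = (case s of
      Round k i \<nu> \<Rightarrow> tptl_equiv P n \<I> k w i \<nu>
    | Reply k i \<nu> l j \<Rightarrow> \<exists>j'. i (\<not> l) < j' \<and> ch k i \<nu> l (\<lambda>s. if s = l then j else j')
    | Choice k i \<nu> l i' \<Rightarrow> ch k i \<nu> l i'
    | Between k i \<nu> l i' m \<Rightarrow> btw k i \<nu> l i' m)" for s
  show ?thesis
  proof (rule winning_strategy_if_invariant[where W = W])
    show "W (Round k i \<nu>)" using eq by (simp add: W_def)
  next
    fix s assume "W s"
    then show "\<not> spoiler_won P n \<I> w s"
      by (cases s) (auto simp: W_def ch_def intro: tptl_equiv_imp_agree)
  next
    fix s t assume s: "W s" "\<not> duplicator_turn s" and "move n w s t"
    from this(3) show "W t"
    proof cases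
      case (1 Y i l j k \<nu>)
      \<comment> \<open>The reset precedes the move, so the reply is found for the updated
        valuations.\<close>
      have "tptl_equiv P n \<I> (Suc k) w i (reset w Y i \<nu>)"
        using s 1 tptl_equiv_reset by (simp add: W_def)
      from tptl_equiv_reply[OF fin this \<open>i l < j\<close>]
      show ?thesis unfolding 1 W_def ch_def btw_def by (simp, metis)
    qed (use s in \<open>auto simp: W_def ch_def\<close>)
  next
    fix s assume s: "W s" "duplicator_turn s"
    show "\<exists>t. move n w s t \<and> W t"
    proof (cases s)
      case (Reply k i \<nu> l j)
      then obtain j' where "i (\<not> l) < j'" "ch k i \<nu> l (\<lambda>s. if s = l then j else j')"
        using s by (auto simp: W_def)
      then show ?thesis unfolding Reply
        by (intro exI[of _ "Choice k i \<nu> l (\<lambda>s. if s = l then j else j')"])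
          (auto simp: W_def intro: move.intros)
    next
      case (Between k i \<nu> l i' m)
      then obtain m' where "i l < m'" "m' < i' l"
        "tptl_equiv P n \<I> k w (\<lambda>s. if s = l then m' else m) \<nu>"
        using s by (auto simp: W_def btw_def)
      then show ?thesis unfolding Between
        by (intro exI[of _ "Round k (\<lambda>s. if s = l then m' else m) \<nu>"])
          (auto simp: W_def intro: move.intros)
    qed (use s in auto)
  qed
qed

section \<open>From the game to definability of sets of data words\<close>

lemma duplicator_wins_TG_iff_tptl_equiv:
  assumes "finite P" "\<I> \<in> FCons" "n \<ge> 1"
  shows "duplicator_wins_TG P n \<I> k w0 i0 \<nu>0 w1 i1 \<nu>1 \<longleftrightarrow>
    tptl_equiv P n \<I> k (two_sides w0 w1) (two_sides i0 i1) (two_sides \<nu>0 \<nu>1)"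
  unfolding duplicator_wins_TG_def
  using tptl_equiv_if_winning_strategy winning_strategy_if_tptl_equiv[OF assms] by blast

theorem theorem5:
  fixes P :: "'p set" and L :: "'p data_word set" and \<I> :: "int extended set" and n k :: nat
  assumes "finite P"
    and "L \<subseteq> data_words P"
    and "\<I> \<in> FCons"
    and "n \<ge> 1"
  shows "\<not> definable P n \<I> k L \<longleftrightarrow>
    (\<exists>w0 \<in> L. \<exists>w1 \<in> data_words P - L.
       duplicator_wins_TG P n \<I> k w0 0 (init_val w0) w1 0 (init_val w1))"
    (is "_ \<longleftrightarrow> ?R")
proof
  assume nondef: "\<not> definable P n \<I> k L"
  show ?R
  proof (rule ccontr)
    assume nR: "\<not> ?R"
    \<comment> \<open>The candidate defining formula describes the classes of all initial
      configurations of words in \<open>L\<close>.\<close>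
    obtain \<phi> where \<phi>: "\<phi> \<in> TPTL P n \<I> k" "\<And>w i \<nu>. sat w i \<nu> \<phi> \<longleftrightarrow> (\<exists>w'\<in>L.
        tptl_equiv P n \<I> k (two_sides w' w) (two_sides 0 i) (two_sides (init_val w') \<nu>))"
      by (rule tptl_equiv_class_formula[OF assms(1,3,4), of k "(\<lambda>w. (w, 0, init_val w)) ` L"]) auto
    have refl: "tptl_equiv P n \<I> k (two_sides v v) (two_sides a a) (two_sides \<mu> \<mu>)" for v a \<mu>
      by (simp add: tptl_equiv_def)
    \<comment> \<open>Words in \<open>L\<close> satisfy \<open>\<phi>\<close> by reflexivity; a word
      of \<open>data_words P - L\<close> satisfying it would give Duplicator a win against some word
      of \<open>L\<close>, contradicting \<open>nR\<close>.\<close>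
    have "models w \<phi> \<longleftrightarrow> w \<in> L" if "w \<in> data_words P" for w
      using nR that refl[of w 0 "init_val w"]
      unfolding models_def \<phi>(2) duplicator_wins_TG_iff_tptl_equiv[OF assms(1,3,4)] by blast
    then have "{w \<in> data_words P. models w \<phi>} = L" using assms(2) by blast
    then show False using nondef \<phi>(1) by (auto simp: definable_def)
  qed
next
  assume ?R
  then obtain w0 w1 where w: "w0 \<in> L" "w1 \<in> data_words P" "w1 \<notin> L"
    and eq: "tptl_equiv P n \<I> k (two_sides w0 w1) (two_sides 0 0)
      (two_sides (init_val w0) (init_val w1))"
    using duplicator_wins_TG_iff_tptl_equiv[OF assms(1,3,4)] by blast
  \<comment> \<open>No formula of rank \<open>k\<close> separates \<open>w0\<close> from
    \<open>w1\<close>, so none can define a set containing only the former.\<close>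
  have "models w0 \<phi> \<longleftrightarrow> models w1 \<phi>" if "\<phi> \<in> TPTL P n \<I> k" for \<phi>
    using eq that by (simp add: models_def tptl_equiv_def)
  then show "\<not> definable P n \<I> k L" using w unfolding definable_def by blast
qed

end
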